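(* Let $n$ be a non-negative integer and let $0\leqslant A',B'\leqslant 2^{n+1}-1$ be integers with binary decompositions $$A'=a_02^0+\dots+a_{n-1}2^{n-1}+a_n2^n,\qquad B'=b_02^0+\dots+b_{n-1}2^{n-1}+b_n2^n,$$ all $a_i,b_i\in\{0,1\}$. Let $\sigma_s$ be the twist function of the split Cayley-Dickson algebra $\mathbb D^{(n+1)}_s$ and let $\sigma$ be the twist function of the Cayley-Dickson algebra $\mathbb D^{(n+1)}$. Then, in $\mathbb Z_2$, $$\sigma_s(A',B')=\sigma(A',B')+a_nb_n.$$
   Context: Cayley-Dickson process: let $\mathcal A$ be a real algebra with a regular involution $a\mapsto\bar a$ (a linear map with $\bar{\bar a}=a$, $\overline{ab}=\bar b\bar a$, and $a+\bar a$, $a\bar a=\bar aa$ scalar multiples of the identity for all $a$), and let $\gamma\in\mathbb R$, $\gamma\neq0$. The algebra $\mathcal A\{\gamma\}$ consists of ordered pairs $(a,b)$ of elements of $\mathcal A$ with componentwise addition and scalar multiplication, product $$(a,b)(c,d)=(ac+\gamma\,\bar d\,b,\ da+b\bar c)$$ and involution $\overline{(a,b)}=(\bar a,-b)$. One identifies $a\in\mathcal A$ with $(a,0)$ and writes $(a,b)=a+bg$ with new generator $g=(0,1)$, so that $g^2=\gamma$. Starting from $\mathbb D^{(0)}=\mathbb R$ with trivial involution, the Cayley-Dickson algebras are $\mathbb D^{(k+1)}=\mathbb D^{(k)}\{-1\}$, with new generator denoted $g_k$. The split Cayley-Dickson algebra is $\mathbb D^{(n+1)}_s=\mathbb D^{(n)}\{1\}$;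 that is, the first $n$ doublings use parameter $-1$ and the last one uses parameter $+1$; its generators are also denoted $g_0,\dots,g_n$. In either algebra, for $p=\sum_{i=0}^n p_i2^i$ with $p_i\in\{0,1\}$, the basis element is $e_p=g_0^{p_0}g_1^{p_1}\cdots g_n^{p_n}$, with the product performed from left to right: $(((g_0^{p_0}g_1^{p_1})g_2^{p_2})\cdots)g_n^{p_n}$ (and $g_i^0=1$). The operation $p\oplus q$ is bitwise addition modulo 2 of binary expansions. Products of basis elements equal $\pm e_{p\oplus q}$, and the twist functions, with values in $\mathbb Z_2$, are defined by $e_pe_q=(-1)^{\sigma(p,q)}e_{p\oplus q}$ in $\mathbb D^{(n+1)}$ and $e_pe_q=(-1)^{\sigma_s(p,q)}e_{p\oplus q}$ in $\mathbb D^{(n+1)}_s$, for $p,q=0,\dots,2^{n+1}-1$. Binary digits are regarded as elements of $\mathbb Z_2$. *)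

theory Defs
  imports Complex_Main "HOL-Library.Z2" "HOL-Algebra.Module"
begin

(* The carrier of the k-th algebra changes with k, so ordered pairs are formed inside one
   type: a value is a real number or a pair of values, and the k-th algebra consists of
   the perfect binary trees of depth k with real leaves. *)
datatype cd = Scalar (real_val: real) | Dbl (left_part: cd) (right_part: cd)

(* Real algebras with involution, not assumed associative or commutative. The record only
   supplies operations and notation. *)
record 'b inv_algebra = "(real, 'b) module" +
  invol :: "'b \<Rightarrow> 'b"

definition real_alg :: "cd inv_algebra" where
  "real_alg = \<lparr>
     carrier = range Scalar,
     mult = (\<lambda>x y. Scalar (real_val x * real_val y)),
     one = Scalar 1,
     zero = Scalar 0,
     add = (\<lambda>x y. Scalar (real_val x + real_val y)),
     smult = (\<lambda>r x. Scalar (r * real_val x)),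
     invol = (\<lambda>x. x) \<rparr>"

context
  fixes A :: "cd inv_algebra" (structure) and \<gamma> :: real
begin

fun dbl_add :: "cd \<Rightarrow> cd \<Rightarrow> cd" where
  "dbl_add (Dbl a b) (Dbl c d) = Dbl (a \<oplus> c) (b \<oplus> d)"

fun dbl_smult :: "real \<Rightarrow> cd \<Rightarrow> cd" where
  "dbl_smult r (Dbl a b) = Dbl (r \<odot> a) (r \<odot> b)"

fun dbl_mult :: "cd \<Rightarrow> cd \<Rightarrow> cd" where
  "dbl_mult (Dbl a b) (Dbl c d) =
     Dbl ((a \<otimes> c) \<oplus> (\<gamma> \<odot> (invol A d \<otimes> b))) ((d \<otimes> a) \<oplus> (b \<otimes> invol A c))"

fun dbl_invol :: "cd \<Rightarrow> cd" where
  "dbl_invol (Dbl a b) = Dbl (invol A a) ((- 1) \<odot> b)"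

definition cd_double :: "cd inv_algebra" where
  "cd_double = \<lparr>
     carrier = {Dbl a b | a b. a \<in> carrier A \<and> b \<in> carrier A},
     mult = dbl_mult,
     one = Dbl \<one> \<zero>,
     zero = Dbl \<zero> \<zero>,
     add = dbl_add,
     smult = dbl_smult,
     invol = dbl_invol \<rparr>"

end

primrec cd_alg :: "nat \<Rightarrow> cd inv_algebra" where
  "cd_alg 0 = real_alg"
| "cd_alg (Suc k) = cd_double (cd_alg k) (- 1)"

(* split_cd_alg n is the split algebra of dimension 2^(n+1), to be compared with
   cd_alg (Suc n). *)
definition split_cd_alg :: "nat \<Rightarrow> cd inv_algebra" where
  "split_cd_alg n = cd_double (cd_alg n) 1"

(* From generators g 0, ..., g (k-1) of A to those of its double: the old ones are
   embedded by a |-> (a, 0), and the k-th one is (0, 1). *)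
definition double_gens :: "cd inv_algebra \<Rightarrow> nat \<Rightarrow> (nat \<Rightarrow> cd) \<Rightarrow> nat \<Rightarrow> cd" where
  "double_gens A k g =
     (\<lambda>i. if i = k then Dbl \<zero>\<^bsub>A\<^esub> \<one>\<^bsub>A\<^esub> else Dbl (g i) \<zero>\<^bsub>A\<^esub>)"

(* cd_gens k i is the generator g_i of cd_alg k; meaningful for i < k only. *)
primrec cd_gens :: "nat \<Rightarrow> nat \<Rightarrow> cd" where
  "cd_gens 0 = (\<lambda>_. undefined)"
| "cd_gens (Suc k) = double_gens (cd_alg k) k (cd_gens k)"

definition split_cd_gens :: "nat \<Rightarrow> nat \<Rightarrow> cd" where
  "split_cd_gens n = double_gens (cd_alg n) n (cd_gens n)"

(* ((f 0 * f 1) * ...) * f n *)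
primrec left_prod :: "cd inv_algebra \<Rightarrow> (nat \<Rightarrow> cd) \<Rightarrow> nat \<Rightarrow> cd" where
  "left_prod A f 0 = f 0"
| "left_prod A f (Suc n) = left_prod A f n \<otimes>\<^bsub>A\<^esub> f (Suc n)"

definition basis_elt :: "cd inv_algebra \<Rightarrow> (nat \<Rightarrow> cd) \<Rightarrow> nat \<Rightarrow> nat \<Rightarrow> cd" where
  "basis_elt A g n p = left_prod A (\<lambda>i. if bit p i then g i else \<one>\<^bsub>A\<^esub>) n"

(* The type bit is the field Z_2; of_bit s is the representative 0 or 1 of s in nat. *)
definition twist_of :: "cd inv_algebra \<Rightarrow> (nat \<Rightarrow> cd) \<Rightarrow> nat \<Rightarrow> nat \<Rightarrow> nat \<Rightarrow> bit" where
  "twist_of A g n p q =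
     (THE s. basis_elt A g n p \<otimes>\<^bsub>A\<^esub> basis_elt A g n q =
        ((- 1) ^ (of_bit s :: nat)) \<odot>\<^bsub>A\<^esub> basis_elt A g n (Bit_Operations.xor p q))"

definition cd_twist :: "nat \<Rightarrow> nat \<Rightarrow> nat \<Rightarrow> bit" where
  "cd_twist n = twist_of (cd_alg (Suc n)) (cd_gens (Suc n)) n"

definition split_cd_twist :: "nat \<Rightarrow> nat \<Rightarrow> nat \<Rightarrow> bit" where
  "split_cd_twist n = twist_of (split_cd_alg n) (split_cd_gens n) n"

end

(* The two algebras share the underlying vector space, the generators and the scalar
   multiplication. The doubling parameter enters a product of basis elements only
   through (0,x)(0,y) = (\<gamma> \<cdot> (conj y * x), 0), i.e. exactly when both top digits are 1;
   there the two products differ by the sign -1. *)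
theory Submission
  imports Defs
begin

(* Only the identities that products of signed basis elements require;
   distributivity of the multiplication is not among them. *)
locale unital_inv_alg =
  fixes A :: "cd inv_algebra" (structure)
  assumes zero_closed [simp, intro]: "\<zero> \<in> carrier A"
    and one_closed [simp, intro]: "\<one> \<in> carrier A"
    and add_closed [simp, intro]: "\<lbrakk>x \<in> carrier A; y \<in> carrier A\<rbrakk> \<Longrightarrow> x \<oplus> y \<in> carrier A"
    and mult_closed [simp, intro]: "\<lbrakk>x \<in> carrier A; y \<in> carrier A\<rbrakk> \<Longrightarrow> x \<otimes> y \<in> carrier A"
    and smult_closed [simp, intro]: "x \<in> carrier A \<Longrightarrow> r \<odot> x \<in> carrier A"
    and invol_closed [simp, intro]: "x \<in> carrier A \<Longrightarrow> invol A x \<in> carrier A"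
    and add_zero [simp]: "x \<in> carrier A \<Longrightarrow> x \<oplus> \<zero> = x"
    and zero_add [simp]: "x \<in> carrier A \<Longrightarrow> \<zero> \<oplus> x = x"
    and mult_zero [simp]: "x \<in> carrier A \<Longrightarrow> x \<otimes> \<zero> = \<zero>"
    and zero_mult [simp]: "x \<in> carrier A \<Longrightarrow> \<zero> \<otimes> x = \<zero>"
    and mult_one [simp]: "x \<in> carrier A \<Longrightarrow> x \<otimes> \<one> = x"
    and one_mult [simp]: "x \<in> carrier A \<Longrightarrow> \<one> \<otimes> x = x"
    and smult_zero [simp]: "r \<odot> \<zero> = \<zero>"
    and one_smult [simp]: "x \<in> carrier A \<Longrightarrow> 1 \<odot> x = x"
    and smult_smult [simp]: "x \<in> carrier A \<Longrightarrow> r \<odot> (s \<odot> x) = (r * s) \<odot> x"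
    and smult_add: "\<lbrakk>x \<in> carrier A; y \<in> carrier A\<rbrakk> \<Longrightarrow> r \<odot> (x \<oplus> y) = r \<odot> x \<oplus> r \<odot> y"
    and smult_mult [simp]:
      "\<lbrakk>x \<in> carrier A; y \<in> carrier A\<rbrakk> \<Longrightarrow> (r \<odot> x) \<otimes> y = r \<odot> (x \<otimes> y)"
    and mult_smult [simp]:
      "\<lbrakk>x \<in> carrier A; y \<in> carrier A\<rbrakk> \<Longrightarrow> x \<otimes> (r \<odot> y) = r \<odot> (x \<otimes> y)"
    and invol_zero [simp]: "invol A \<zero> = \<zero>"
    and invol_one [simp]: "invol A \<one> = \<one>"
    and invol_smult [simp]: "x \<in> carrier A \<Longrightarrow> invol A (r \<odot> x) = r \<odot> invol A x"

lemma cd_double_simps [simp]: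
  "carrier (cd_double A \<gamma>) = {Dbl a b | a b. a \<in> carrier A \<and> b \<in> carrier A}"
  "mult (cd_double A \<gamma>) = dbl_mult A \<gamma>"
  "one (cd_double A \<gamma>) = Dbl \<one>\<^bsub>A\<^esub> \<zero>\<^bsub>A\<^esub>"
  "zero (cd_double A \<gamma>) = Dbl \<zero>\<^bsub>A\<^esub> \<zero>\<^bsub>A\<^esub>"
  "add (cd_double A \<gamma>) = dbl_add A"
  "smult (cd_double A \<gamma>) = dbl_smult A"
  "invol (cd_double A \<gamma>) = dbl_invol A"
  by (simp_all add: cd_double_def)

lemma unital_inv_alg_real: "unital_inv_alg real_alg"
  by unfold_locales (auto simp: real_alg_def algebra_simps)

text \<open>Each identity of the double reduces to identities of \<open>A\<close> in the two
  components, for every \<gamma>. A real factor leaves a sum of two products by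
  \<open>smult_add\<close> and passes \<gamma> by commutativity of the reals.\<close>

lemma (in unital_inv_alg) unital_inv_alg_double: "unital_inv_alg (cd_double A \<gamma>)"
  by unfold_locales (auto simp: smult_add mult.commute)

lemma unital_inv_alg_cd_alg: "unital_inv_alg (cd_alg k)"
  by (induction k) (simp_all add: unital_inv_alg_real unital_inv_alg.unital_inv_alg_double)

(* Digits of p in positions k and above are ignored. *)
primrec tree_basis :: "nat \<Rightarrow> nat \<Rightarrow> cd" where
  "tree_basis 0 p = Scalar 1"
| "tree_basis (Suc k) p =
     (if bit p k then Dbl \<zero>\<^bsub>cd_alg k\<^esub> (tree_basis k p) else Dbl (tree_basis k p) \<zero>\<^bsub>cd_alg k\<^esub>)"

lemma tree_basis_closed: "tree_basis k p \<in> carrier (cd_alg k)"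
proof (induction k)
  case 0
  show ?case by (simp add: real_alg_def)
next
  case (Suc k)
  interpret unital_inv_alg "cd_alg k" by (rule unital_inv_alg_cd_alg)
  from Suc show ?case by simp
qed

text \<open>Exactly one leaf of \<open>tree_basis k p\<close> is 1 and all others are 0; comparing
  that leaf gives the claim. It makes the sign in a product of basis elements unique.\<close>

lemma tree_basis_smult_inject:
  "r \<odot>\<^bsub>cd_alg k\<^esub> tree_basis k p = s \<odot>\<^bsub>cd_alg k\<^esub> tree_basis k p \<Longrightarrow> r = s"
  by (induction k) (auto simp: real_alg_def split: if_splits)

text \<open>If the top digit is 1, the element is (0, x) and conjugation negates it; otherwise it is
  (x, 0) and the sign comes from the level below.\<close>

lemma tree_basis_invol:
  "\<exists>s\<in>{1, - 1}. invol (cd_alg k) (tree_basis k p) = s \<odot>\<^bsub>cd_alg k\<^esub> tree_basis k p"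
proof (induction k)
  case 0
  show ?case by (simp add: real_alg_def)
next
  case (Suc k)
  interpret unital_inv_alg "cd_alg k" by (rule unital_inv_alg_cd_alg)
  from Suc show ?case by auto
qed

text \<open>For basis elements x, y one level down, the four cases are (x,0)(y,0) = (xy,0),
  (x,0)(0,y) = (0,yx), (0,x)(y,0) = (0, x conj y) and (0,x)(0,y) = (-(conj y) x, 0).\<close>

lemma tree_basis_mult:
  "\<exists>s\<in>{1, - 1}. tree_basis k p \<otimes>\<^bsub>cd_alg k\<^esub> tree_basis k q =
     s \<odot>\<^bsub>cd_alg k\<^esub> tree_basis k (Bit_Operations.xor p q)"
proof (induction k arbitrary: p q)
  case 0
  show ?case by (simp add: real_alg_def)
next
  case (Suc k)
  interpret unital_inv_alg "cd_alg k" by (rule unital_inv_alg_cd_alg)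
  note closed = tree_basis_closed [of k]
  obtain s where s: "s \<in> {1, - 1}"
    "tree_basis k p \<otimes>\<^bsub>cd_alg k\<^esub> tree_basis k q =
       s \<odot>\<^bsub>cd_alg k\<^esub> tree_basis k (Bit_Operations.xor p q)"
    using Suc by blast
  \<comment> \<open>The order of the factors is reversed when the second one has top digit 1, whence
    the induction hypothesis with \<open>p\<close> and \<open>q\<close> swapped.\<close>
  obtain t where t: "t \<in> {1, - 1}"
    "tree_basis k q \<otimes>\<^bsub>cd_alg k\<^esub> tree_basis k p =
       t \<odot>\<^bsub>cd_alg k\<^esub> tree_basis k (Bit_Operations.xor p q)"
    using Suc [of q p] by (auto simp: xor.commute)
  obtain u where u: "u \<in> {1, - 1}"
    "invol (cd_alg k) (tree_basis k q) = u \<odot>\<^bsub>cd_alg k\<^esub> tree_basis k q"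
    using tree_basis_invol by blast
  consider "\<not> bit p k" "\<not> bit q k" | "\<not> bit p k" "bit q k" | "bit p k" "\<not> bit q k"
    | "bit p k" "bit q k" by blast
  then show ?case
  proof cases
    case 1
    with s show ?thesis by (intro bexI [of _ s]) (simp_all add: bit_xor_iff closed)
  next
    case 2
    with t show ?thesis by (intro bexI [of _ t]) (simp_all add: bit_xor_iff closed)
  next
    case 3
    with s u show ?thesis
      by (intro bexI [of _ "u * s"]) (auto simp add: bit_xor_iff closed)
  next
    case 4
    \<comment> \<open>The sign collects \<open>u\<close> from conjugating the second factor,
      \<open>t\<close> from the reversed product and -1 from the doubling parameter.\<close>
    with t u show ?thesis
      by (intro bexI [of _ "- (u * t)"]) (auto simp add: bit_xor_iff closed)
  qed
qed

text \<open>The embedding a \<mapsto> (a, 0) is multiplicative for every \<gamma>, since the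
  \<gamma>-term vanishes. Closure is carried through the same induction because the zero laws are
  available on the carrier only.\<close>

lemma left_prod_embed:
  assumes "unital_inv_alg A" and "\<And>i. i \<le> m \<Longrightarrow> f i \<in> carrier A"
    and "\<And>i. i \<le> m \<Longrightarrow> h i = Dbl (f i) \<zero>\<^bsub>A\<^esub>"
  shows "left_prod A f m \<in> carrier A \<and>
    left_prod (cd_double A \<gamma>) h m = Dbl (left_prod A f m) \<zero>\<^bsub>A\<^esub>"
proof -
  interpret unital_inv_alg A by fact
  show ?thesis using assms(2,3) by (induction m) simp_all
qed

lemma cd_gens_closed: "i < k \<Longrightarrow> cd_gens k i \<in> carrier (cd_alg k)"
proof (induction k)
  case 0
  then show ?case by simp
next
  case (Suc k)
  interpret unital_inv_alg "cd_alg k" by (rule unital_inv_alg_cd_alg)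
  from Suc show ?case by (auto simp: double_gens_def)
qed

text \<open>The right-hand side is free of \<gamma>, so the ordinary and the split algebra have the
  same basis elements. The factors before the last are embedded from \<open>cd_alg n\<close>; the
  last one multiplies (x, 0) by (0, 1) or (1, 0), giving (0, x) or (x, 0).\<close>

lemma basis_elt_double:
  "basis_elt (cd_double (cd_alg n) \<gamma>) (double_gens (cd_alg n) n (cd_gens n)) n p =
     tree_basis (Suc n) p"
proof (induction n arbitrary: \<gamma>)
  case 0
  show ?case by (simp add: basis_elt_def double_gens_def real_alg_def)
next
  case (Suc m)
  let ?A = "cd_alg (Suc m)"
  interpret unital_inv_alg ?A by (rule unital_inv_alg_cd_alg)
  define f where "f = (\<lambda>i. if bit p i then cd_gens (Suc m) i else \<one>\<^bsub>?A\<^esub>)"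
  define h where "h = (\<lambda>i. if bit p i then double_gens ?A (Suc m) (cd_gens (Suc m)) i
                           else \<one>\<^bsub>cd_double ?A \<gamma>\<^esub>)"
  have f_closed: "f i \<in> carrier ?A" if "i \<le> m" for i
    unfolding f_def using that one_closed cd_gens_closed [of i "Suc m"] by (auto simp del: cd_alg.simps)
  \<comment> \<open>The algebra \<open>?A\<close> is itself the double of \<open>cd_alg m\<close>
    with parameter -1, so the induction hypothesis is used at that parameter.\<close>
  have f: "left_prod ?A f m = tree_basis (Suc m) p"
    using Suc [of "- 1"] by (simp only: basis_elt_def f_def cd_alg.simps cd_gens.simps)
  have h: "h i = Dbl (f i) \<zero>\<^bsub>?A\<^esub>" if "i \<le> m" for i
    using that by (simp add: f_def h_def double_gens_def)
  have "left_prod (cd_double ?A \<gamma>) h m = Dbl (tree_basis (Suc m) p) \<zero>\<^bsub>?A\<^esub>"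
    using left_prod_embed [OF unital_inv_alg_cd_alg f_closed h] f by simp
  moreover have "h (Suc m) = (if bit p (Suc m) then Dbl \<zero>\<^bsub>?A\<^esub> \<one>\<^bsub>?A\<^esub> else Dbl \<one>\<^bsub>?A\<^esub> \<zero>\<^bsub>?A\<^esub>)"
    by (simp add: h_def double_gens_def)
  moreover have "basis_elt (cd_double ?A \<gamma>) (double_gens ?A (Suc m) (cd_gens (Suc m))) (Suc m) p
      = dbl_mult ?A \<gamma> (left_prod (cd_double ?A \<gamma>) h m) (h (Suc m))"
    unfolding basis_elt_def h_def [symmetric] by simp
  \<comment> \<open>Only the outermost node is unfolded; \<open>?A\<close> stays folded so that its
    algebra identities apply.\<close>
  ultimately show ?case
    using tree_basis_closed [of "Suc m" p]
    by (simp del: cd_alg.simps tree_basis.simps(2) add: tree_basis.simps(2) [of "Suc m"])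
qed

lemma cd_basis_elt: "basis_elt (cd_alg (Suc n)) (cd_gens (Suc n)) n p = tree_basis (Suc n) p"
  using basis_elt_double [of n "- 1"] by simp

lemma split_cd_basis_elt:
  "basis_elt (split_cd_alg n) (split_cd_gens n) n p = tree_basis (Suc n) p"
  by (simp only: split_cd_alg_def split_cd_gens_def basis_elt_double)

text \<open>One doubling is unfolded while products in \<open>cd_alg n\<close> remain symbolic, so
  their signs are never computed.\<close>

lemma split_cd_mult_tree_basis:
  "tree_basis (Suc n) p \<otimes>\<^bsub>split_cd_alg n\<^esub> tree_basis (Suc n) q =
     (if bit p n \<and> bit q n then - 1 else 1) \<odot>\<^bsub>cd_alg (Suc n)\<^esub>
       (tree_basis (Suc n) p \<otimes>\<^bsub>cd_alg (Suc n)\<^esub> tree_basis (Suc n) q)"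
proof -
  interpret unital_inv_alg "cd_alg n" by (rule unital_inv_alg_cd_alg)
  show ?thesis
    using tree_basis_closed [of n] by (simp add: split_cd_alg_def)
qed

text \<open>The map s \<mapsto> (-1)^s is a homomorphism from Z_2 to the real signs, so an extra
  sign of a product becomes a summand of the twist.\<close>

lemma sign_of_bit_add:
  "((- 1) ^ (of_bit (s + t) :: nat) :: real) = (- 1) ^ (of_bit s :: nat) * (- 1) ^ (of_bit t :: nat)"
  by (cases s; cases t) simp_all

lemma sign_of_bit_eq_iff:
  "((- 1) ^ (of_bit s :: nat) :: real) = (- 1) ^ (of_bit t :: nat) \<longleftrightarrow> s = t"
  by (cases s; cases t) simp_all

lemma split_cd_twist_eq:
  "split_cd_twist n p q = cd_twist n p q + of_bool (bit p n \<and> bit q n)"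
proof -
  let ?A = "cd_alg (Suc n)" and ?e = "tree_basis (Suc n)" and ?pq = "Bit_Operations.xor p q"
  interpret unital_inv_alg ?A by (rule unital_inv_alg_cd_alg)
  define c :: bit where "c = of_bool (bit p n \<and> bit q n)"
  \<comment> \<open>Scaling in a double is independent of \<gamma>, so signs in the two algebras can
    be compared.\<close>
  have smult: "smult (split_cd_alg n) = smult ?A"
    by (simp add: split_cd_alg_def)
  obtain r where "r \<in> {1, - 1}" and r: "?e p \<otimes>\<^bsub>?A\<^esub> ?e q = r \<odot>\<^bsub>?A\<^esub> ?e ?pq"
    using tree_basis_mult by blast
  then obtain s :: bit where s: "r = (- 1) ^ (of_bit s :: nat)"
    using that [of 0] that [of 1] by auto
  have "?e p \<otimes>\<^bsub>split_cd_alg n\<^esub> ?e q = (- 1) ^ (of_bit c :: nat) \<odot>\<^bsub>?A\<^esub> (r \<odot>\<^bsub>?A\<^esub> ?e ?pq)"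
    unfolding split_cd_mult_tree_basis r c_def by simp
  also have "\<dots> = (- 1) ^ (of_bit (s + c) :: nat) \<odot>\<^bsub>?A\<^esub> ?e ?pq"
    by (simp only: smult_smult tree_basis_closed s sign_of_bit_add mult.commute)
  finally have split: "?e p \<otimes>\<^bsub>split_cd_alg n\<^esub> ?e q = (- 1) ^ (of_bit (s + c) :: nat) \<odot>\<^bsub>?A\<^esub> ?e ?pq" .
  \<comment> \<open>With this, the condition inside each definite description becomes an equation
    between bits, which has exactly one solution.\<close>
  have eq_iff: "(- 1) ^ (of_bit t :: nat) \<odot>\<^bsub>?A\<^esub> ?e ?pq = (- 1) ^ (of_bit u :: nat) \<odot>\<^bsub>?A\<^esub> ?e ?pq \<longleftrightarrow> t = u"
    for t u :: bit
    using tree_basis_smult_inject sign_of_bit_eq_iff by blast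
  have "cd_twist n p q = s"
    unfolding cd_twist_def twist_of_def cd_basis_elt r s eq_iff by simp
  moreover have "split_cd_twist n p q = s + c"
    unfolding split_cd_twist_def twist_of_def split_cd_basis_elt split smult eq_iff by simp
  ultimately show ?thesis by (simp add: c_def)
qed

text \<open>The lower digits contribute less than 2^n, so division by 2^n leaves exactly
  \<open>a n\<close>.\<close>

lemma of_bool_bit_top_digit:
  fixes a :: "nat \<Rightarrow> nat"
  assumes "\<And>i. i \<le> n \<Longrightarrow> a i \<in> {0, 1}"
  shows "of_bool (bit (\<Sum>i\<le>n. a i * 2 ^ i) n) = a n"
proof -
  have "(\<Sum>i<m. a i * 2 ^ i) < 2 ^ m" if "m \<le> n" for m
    using that
  proof (induction m)
    case (Suc m)
    then show ?case using assms [of m] by auto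
  qed simp
  then have "(\<Sum>i\<le>n. a i * 2 ^ i) div 2 ^ n = a n"
    by (simp add: lessThan_Suc_atMost [symmetric])
  then show ?thesis using assms [of n] by (auto simp: bit_iff_odd)
qed

theorem theorem2:
  fixes n A' B' :: nat and a b :: "nat \<Rightarrow> nat"
  assumes "A' \<le> 2 ^ (n + 1) - 1" and "B' \<le> 2 ^ (n + 1) - 1"
    and "\<And>i. i \<le> n \<Longrightarrow> a i \<in> {0, 1}" and "\<And>i. i \<le> n \<Longrightarrow> b i \<in> {0, 1}"
    and "A' = (\<Sum>i\<le>n. a i * 2 ^ i)" and "B' = (\<Sum>i\<le>n. b i * 2 ^ i)"
  shows "split_cd_twist n A' B' = cd_twist n A' B' + (of_nat (a n) * of_nat (b n) :: bit)"
proof -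
  have "a n = of_bool (bit A' n)" "b n = of_bool (bit B' n)"
    using of_bool_bit_top_digit assms(3-6) by metis+
  \<comment> \<open>In Z_2 the product of two digits is the truth value of the conjunction of the
    two bits.\<close>
  then show ?thesis by (simp add: split_cd_twist_eq)
qed

end
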